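(* Let $k$ be a field, let $n,d$ be positive integers, let $R_d^n=k[x_1,\dots,x_n]/\mathfrak{m}^d$ where $\mathfrak{m}=(x_1,\dots,x_n)$, and let $S$ be any finite set of ideals of $R_d^n$. Then the Hilbert--Dyck series $$\mathrm{HD}_d(t):=\sum_{w\in\mathcal{D}(S)}\dim_k\bigl(\mathrm{Spl}_{R_d^n}(T(w))\bigr)\,t^{|E_{T(w)}|}$$ is algebraic.
   Context: The Dyck language $\mathcal{D}(S)$ is the set of words (including the empty word) in the alphabet $\{(_\alpha,\,)_\alpha\mid\alpha\in S\}$ that are properly nested sequences of parentheses, each left parenthesis being closed by a right parenthesis with the same label. For $w\in\mathcal{D}(S)$ the planar rooted tree $T(w)$ with edge-labels in $S$ is defined recursively: the empty word gives the one-vertex tree; if $w=(_{\alpha_1}w_1)_{\alpha_1}\cdots(_{\alpha_m}w_m)_{\alpha_m}$ with $w_i\in\mathcal{D}(S)$, then $T(w)$ has $m$ edges out of its root, labeled $\alpha_1,\dots,\alpha_m$ from left to right, the $i$-th one attached to the root of $T(w_i)$. This is a bijection between $\mathcal{D}(S)$ and planar rooted trees with edge-labels in $S$; $|E_{T(w)}|$, the number of edges of $T(w)$, is half the length of $w$. For a commutative ring $R$ and a tree $T$ with vertex set $V_T$ and edges labeled by ideals of $R$ via $\alpha$, $\mathrm{Spl}_R(T)$ is the $R$-module of all $\mathbf p\in\bigoplus_{v\in V_T}R$ with $\mathbf p_u-\mathbf p_v\in\alpha(e)$ for each edge $e$ with endpoints $u,v$. A formal power series $F(t)$ is algebraic if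 there is a nonzero polynomial $P(x,t)$ with rational coefficients such that $P(F(t),t)=0$. *)

theory Defs
  imports
    "Jordan_Normal_Form.VS_Connect"
    "HOL-Algebra.QuotRing"
    "HOL-Algebra.Ideal_Product"
    "HOL-Library.Poly_Mapping"
    "HOL-Computational_Algebra.Polynomial_FPS"
begin

section \<open>Dyck words and planar rooted trees\<close>

datatype 'a paren = Open 'a | Close 'a

inductive_set dyck :: "'a set \<Rightarrow> 'a paren list set" for S :: "'a set" where
  empty: "[] \<in> dyck S"
| wrap: "\<alpha> \<in> S \<Longrightarrow> w \<in> dyck S \<Longrightarrow> Open \<alpha> # w @ [Close \<alpha>] \<in> dyck S"
| append: "v \<in> dyck S \<Longrightarrow> w \<in> dyck S \<Longrightarrow> v @ w \<in> dyck S"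

text \<open>A node carries the list, from left to right, of its outgoing edges, each given by its label
  and the subtree attached to it.\<close>

datatype 'a ptree = Node "('a \<times> 'a ptree) list"

text \<open>\<open>word_tree w t\<close> is the graph of the recursion for \<open>T(w)\<close>: \<open>ws\<close> is the list of pairs
  \<open>(\<alpha>\<^sub>i, w\<^sub>i)\<close> of the decomposition of \<open>w\<close>, and \<open>ts\<close> is the list of pairs \<open>(\<alpha>\<^sub>i, T(w\<^sub>i))\<close>.
  The lemma \<open>word_tree_ex1\<close> below shows that it determines a tree for every Dyck word.\<close>

inductive word_tree :: "'a paren list \<Rightarrow> 'a ptree \<Rightarrow> bool" where
  Node: "list_all2 (\<lambda>p q. fst p = fst q \<and> word_tree (snd p) (snd q)) ws ts \<Longrightarrow>
    word_tree (concat (map (\<lambda>p. Open (fst p) # snd p @ [Close (fst p)]) ws)) (Node ts)"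

definition tree_of_word :: "'a paren list \<Rightarrow> 'a ptree" where
  "tree_of_word w = (THE t. word_tree w t)"

fun forest_word :: "('a \<times> 'a ptree) list \<Rightarrow> 'a paren list" where
  "forest_word [] = []"
| "forest_word ((\<alpha>, Node us) # ts) = Open \<alpha> # forest_word us @ Close \<alpha> # forest_word ts"

lemma forest_word_unique:
  assumes "forest_word ts @ r = forest_word ts' @ r'"
    and "\<forall>\<alpha> s. r \<noteq> Open \<alpha> # s" and "\<forall>\<alpha> s. r' \<noteq> Open \<alpha> # s"
  shows "ts = ts' \<and> r = r'"
  using assms
proof (induction ts arbitrary: ts' r r' rule: forest_word.induct)
  case 1
  then show ?case by (cases ts' rule: forest_word.cases) auto
next
  case (2 \<alpha> us ts)
  show ?case
  proof (cases ts' rule: forest_word.cases)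
    case 1
    then show ?thesis using "2.prems" by auto
  next
    case (2 \<beta> us' ts'')
    then have eq: "forest_word us @ (Close \<alpha> # forest_word ts @ r)
        = forest_word us' @ (Close \<beta> # forest_word ts'' @ r')" and "\<alpha> = \<beta>"
      using "2.prems" by auto
    from "2.IH"(1)[OF eq] have "us = us'" "forest_word ts @ r = forest_word ts'' @ r'" by auto
    with "2.IH"(2)[of r ts'' r'] "2.prems" \<open>\<alpha> = \<beta>\<close> 2 show ?thesis by simp
  qed
qed

lemma word_tree_forest_word: "word_tree w (Node ts) \<Longrightarrow> w = forest_word ts"
proof (induction w "Node ts" arbitrary: ts rule: word_tree.induct)
  case (Node ws ts)
  then show ?case
  proof (induction rule: list_all2_induct)
    case (Cons p ws q ts)
    then show ?case by (cases q; cases "snd q") auto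
  qed simp
qed

lemma word_tree_ex: "w \<in> dyck S \<Longrightarrow> \<exists>t. word_tree w t"
proof (induction rule: dyck.induct)
  case empty
  show ?case using word_tree.Node[of "[]" "[]"] by auto
next
  case (wrap \<alpha> w)
  then obtain t where "word_tree w t" by blast
  then show ?case using word_tree.Node[of "[(\<alpha>, w)]" "[(\<alpha>, t)]"] by auto
next
  case (append v w)
  then obtain s t where "word_tree v s" "word_tree w t" by blast
  then show ?case
  proof (elim word_tree.cases)
    fix ws1 ts1 ws2 ts2
    assume *: "v = concat (map (\<lambda>p. Open (fst p) # snd p @ [Close (fst p)]) ws1)"
      "w = concat (map (\<lambda>p. Open (fst p) # snd p @ [Close (fst p)]) ws2)"
      and "list_all2 (\<lambda>p q. fst p = fst q \<and> word_tree (snd p) (snd q)) ws1 ts1"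
      "list_all2 (\<lambda>p q. fst p = fst q \<and> word_tree (snd p) (snd q)) ws2 ts2"
    then have "list_all2 (\<lambda>p q. fst p = fst q \<and> word_tree (snd p) (snd q)) (ws1 @ ws2) (ts1 @ ts2)"
      by (simp add: list_all2_appendI)
    from word_tree.Node[OF this] show ?thesis using * by auto
  qed
qed

lemma word_tree_ex1:
  assumes "w \<in> dyck S"
  shows "\<exists>!t. word_tree w t"
proof -
  obtain t where "word_tree w t" using word_tree_ex[OF assms] by blast
  moreover have "t' = t" if "word_tree w t'" for t'
  proof -
    obtain ts ts' where [simp]: "t = Node ts" "t' = Node ts'" by (metis ptree.exhaust)
    have "forest_word ts = forest_word ts'"
      using that \<open>word_tree w t\<close> word_tree_forest_word by auto
    then show ?thesis using forest_word_unique[of ts "[]" ts' "[]"] by auto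
  qed
  ultimately show ?thesis by blast
qed

lemma size_branch [termination_simp]:
  "i < length ts \<Longrightarrow> size (snd (ts ! i)) < Suc (size_list (\<lambda>x. Suc (size (snd x))) ts)"
  by (metis less_SucI lessI nth_mem size_list_estimation)

text \<open>A vertex is given by its path from the root \<open>[]\<close>: \<open>i # u\<close> is the vertex \<open>u\<close> of the
  \<open>i\<close>-th subtree (counted from 0). An edge is a triple of its upper endpoint, its lower endpoint
  and its label.\<close>

fun tree_vertices :: "'a ptree \<Rightarrow> nat list set" where
  "tree_vertices (Node ts) =
     insert [] (\<Union>i\<in>{..<length ts}. (\<lambda>u. i # u) ` tree_vertices (snd (ts ! i)))"

fun tree_edges :: "'a ptree \<Rightarrow> (nat list \<times> nat list \<times> 'a) set" where
  "tree_edges (Node ts) =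
     (\<Union>i\<in>{..<length ts}. insert ([], [i], fst (ts ! i))
        ((\<lambda>(u, v, \<alpha>). (i # u, i # v, \<alpha>)) ` tree_edges (snd (ts ! i))))"

section \<open>Generalized splines\<close>

text \<open>The module of splines on the graph with vertex set \<open>V\<close> and edges \<open>E\<close>, where
  \<open>(u, v, I) \<in> E\<close> stands for an edge with endpoints \<open>u\<close>, \<open>v\<close> that is labeled by the ideal \<open>I\<close>.
  The direct sum of copies of \<open>R\<close> over the finite set \<open>V\<close> is the set of functions
  \<open>V \<rightarrow>\<^sub>E carrier R\<close>. The record type for modules also asks for a multiplication and a one,
  which play no role for the module structure.\<close>

definition Spl :: "('r, 'b) ring_scheme \<Rightarrow> 'v set \<Rightarrow> ('v \<times> 'v \<times> 'r set) set \<Rightarrow> ('r, 'v \<Rightarrow> 'r) module"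
  where
  "Spl R V E =
    \<lparr>carrier = {p \<in> V \<rightarrow>\<^sub>E carrier R. \<forall>(u, v, I)\<in>E. p u \<ominus>\<^bsub>R\<^esub> p v \<in> I},
     monoid.mult = (\<lambda>p q. \<lambda>v\<in>V. p v \<otimes>\<^bsub>R\<^esub> q v),
     monoid.one = (\<lambda>v\<in>V. \<one>\<^bsub>R\<^esub>),
     ring.zero = (\<lambda>v\<in>V. \<zero>\<^bsub>R\<^esub>),
     ring.add = (\<lambda>p q. \<lambda>v\<in>V. p v \<oplus>\<^bsub>R\<^esub> q v),
     module.smult = (\<lambda>r p. \<lambda>v\<in>V. r \<otimes>\<^bsub>R\<^esub> p v)\<rparr>"

text \<open>The \<open>R\<close>-module \<open>M\<close> viewed as a \<open>k\<close>-module along a ring homomorphism \<open>\<phi> : k \<rightarrow> R\<close>.\<close>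

definition restrict_scalars :: "('k \<Rightarrow> 'r) \<Rightarrow> ('r, 'm) module \<Rightarrow> ('k, 'm) module" where
  "restrict_scalars \<phi> M =
    \<lparr>carrier = carrier M, monoid.mult = monoid.mult M, monoid.one = monoid.one M,
     ring.zero = ring.zero M, ring.add = ring.add M,
     module.smult = (\<lambda>c. module.smult M (\<phi> c))\<rparr>"

section \<open>Truncated polynomial rings\<close>

text \<open>Polynomials in countably many variables over \<open>'k\<close> are finitely supported functions from
  monomials to coefficients, a monomial being a finitely supported exponent vector.
  \<open>poly_ring n\<close> is the subring of those that only involve the variables with index in
  \<open>{..<n}\<close>. With \<open>\<mm> = var_ideal n\<close>, the ring \<open>k[x\<^sub>1,\<dots>,x\<^sub>n]/\<mm>\<^sup>d\<close> is \<open>trunc_ring n d\<close>, and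
  \<open>trunc_const n d\<close> is the structure map from \<open>k\<close> to it. The power of \<open>\<mm>\<close> is taken with
  respect to the product of ideals.\<close>

type_synonym 'k mpoly = "(nat \<Rightarrow>\<^sub>0 nat) \<Rightarrow>\<^sub>0 'k"

definition poly_ring :: "nat \<Rightarrow> 'k::field mpoly ring" where
  "poly_ring n =
     class_ring\<lparr>carrier := {p. \<forall>m\<in>Poly_Mapping.keys p. Poly_Mapping.keys m \<subseteq> {..<n}}\<rparr>"

definition mvar :: "nat \<Rightarrow> 'k::field mpoly" where
  "mvar i = Poly_Mapping.single (Poly_Mapping.single i 1) 1"

definition mconst :: "'k::field \<Rightarrow> 'k mpoly" where
  "mconst c = Poly_Mapping.single 0 c"

definition var_ideal :: "nat \<Rightarrow> 'k::field mpoly set" where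
  "var_ideal n = Idl\<^bsub>poly_ring n\<^esub> (mvar ` {..<n})"

definition var_ideal_power :: "nat \<Rightarrow> nat \<Rightarrow> 'k::field mpoly set" where
  "var_ideal_power n d = var_ideal n [^]\<^bsub>ideals_set (poly_ring n)\<^esub> d"

definition trunc_ring :: "nat \<Rightarrow> nat \<Rightarrow> 'k::field mpoly set ring" where
  "trunc_ring n d = poly_ring n Quot var_ideal_power n d"

definition trunc_const :: "nat \<Rightarrow> nat \<Rightarrow> 'k::field \<Rightarrow> 'k mpoly set" where
  "trunc_const n d c = var_ideal_power n d +>\<^bsub>poly_ring n\<^esub> mconst c"

section \<open>The Hilbert--Dyck series\<close>

text \<open>\<open>dim_Spl n d T\<close> is the dimension of the spline module of \<open>T\<close> over \<open>'k\<close>.\<close>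

definition dim_Spl :: "nat \<Rightarrow> nat \<Rightarrow> 'k::field mpoly set set ptree \<Rightarrow> nat" where
  "dim_Spl n d T = vectorspace.dim (class_ring :: 'k ring)
     (restrict_scalars (trunc_const n d)
       (Spl (trunc_ring n d) (tree_vertices T) (tree_edges T)))"

text \<open>Collecting equal powers of \<open>t\<close>, the coefficient of \<open>t\<^sup>m\<close> is the sum over all Dyck words
  whose tree has \<open>m\<close> edges. There are finitely many of them when \<open>S\<close> is finite.\<close>

definition HD :: "nat \<Rightarrow> nat \<Rightarrow> 'k::field mpoly set set set \<Rightarrow> rat fps" where
  "HD n d S = Abs_fps (\<lambda>m.
     \<Sum>w | w \<in> dyck S \<and> card (tree_edges (tree_of_word w)) = m.
       of_nat (dim_Spl n d (tree_of_word w)))"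

text \<open>In \<open>P(x, t)\<close> the outer polynomial variable is \<open>x\<close> and the inner one is \<open>t\<close>.\<close>

definition algebraic_fps :: "rat fps \<Rightarrow> bool" where
  "algebraic_fps F \<longleftrightarrow> (\<exists>P :: rat poly poly. P \<noteq> 0 \<and> poly (map_poly fps_of_poly P) F = 0)"

end

theory Submission
  imports Defs
begin

text \<open>
  Write \<open>p\<close> for a spline on a rooted tree \<open>T\<close>. Its value at the root is arbitrary, and its value at
  the lower endpoint of an edge \<open>e\<close> is its value at the upper endpoint plus an arbitrary element of
  the ideal \<open>\<alpha>(e)\<close>. Hence \<open>dim Spl(T) = D + \<Sum>\<^sub>e dim \<alpha>(e)\<close> with \<open>D = dim R\<close>.

  Let \<open>s = card S\<close> and \<open>a = \<Sum>\<alpha>\<in>S. dim \<alpha>\<close>, let \<open>N\<close> count the trees with labels in \<open>S\<close> by number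
  of edges, and let \<open>W\<close> count them weighted by \<open>\<Sum>\<^sub>e dim \<alpha>(e)\<close>. Splitting off the leftmost edge at the
  root gives \<open>N = 1 + t s N\<^sup>2\<close> and \<open>W = t (a N\<^sup>2 + 2 s N W)\<close>, and the series in question is
  \<open>H = D N + W\<close>. With \<open>\<Delta> = 1 - 2 s t N\<close>, so that \<open>\<Delta>\<^sup>2 = 1 - 4 s t\<close>, eliminating \<open>N\<close> and \<open>W\<close> yields
  \<open>\<Delta> (2 s\<^sup>2 t H + a - D s) = a - 2 s t a - D s (1 - 4 s t)\<close>, whose square is a quadratic equation
  for \<open>H\<close> over the polynomials in \<open>t\<close>.
\<close>

unbundle fps_syntax
no_notation vec_index (infixl "$" 100)

section \<open>Dyck words and forests\<close>

lemma word_tree_appendI: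
  assumes "word_tree w (Node us)" "word_tree w' (Node ts)"
  shows "word_tree (Open \<alpha> # w @ Close \<alpha> # w') (Node ((\<alpha>, Node us) # ts))"
proof -
  from assms(2) obtain ws where
    ws: "w' = concat (map (\<lambda>p. Open (fst p) # snd p @ [Close (fst p)]) ws)"
    "list_all2 (\<lambda>p q. fst p = fst q \<and> word_tree (snd p) (snd q)) ws ts"
    by (cases rule: word_tree.cases) auto
  with assms(1) show ?thesis
    using word_tree.Node[of "(\<alpha>, w) # ws" "(\<alpha>, Node us) # ts"] by simp
qed

lemma word_tree_forest_word_self: "word_tree (forest_word ts) (Node ts)"
proof (induction ts rule: forest_word.induct)
  case 1
  show ?case using word_tree.Node[of "[]" "[]"] by simp
next
  case (2 \<alpha> us ts)
  then show ?case by (simp add: word_tree_appendI)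
qed

text \<open>Lists of branches at a root, generated by splitting off the first branch. Unlike a Dyck
  word built with \<open>dyck.append\<close>, each list arises in exactly one way, which is what
  counting by recursion needs.\<close>

inductive_set forests :: "'a set \<Rightarrow> ('a \<times> 'a ptree) list set" for S :: "'a set" where
  Nil: "[] \<in> forests S"
| Cons: "\<alpha> \<in> S \<Longrightarrow> us \<in> forests S \<Longrightarrow> ts \<in> forests S \<Longrightarrow> (\<alpha>, Node us) # ts \<in> forests S"

lemma forest_word_append: "forest_word (ts @ ts') = forest_word ts @ forest_word ts'"
  by (induction ts rule: forest_word.induct) auto

lemma append_in_forests: "ts \<in> forests S \<Longrightarrow> ts' \<in> forests S \<Longrightarrow> ts @ ts' \<in> forests S"
  by (induction rule: forests.induct) (auto intro: forests.intros)

lemma inj_forest_word: "inj forest_word"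
  by (rule injI) (use forest_word_unique[of _ "[]" _ "[]"] in auto)

text \<open>\<open>forest_word\<close> turns concatenation of branch lists into concatenation of
  words, so its image is closed under the rules of \<open>dyck\<close>. Together with
  \<open>inj_forest_word\<close> this lets sums over words be reindexed by forests.\<close>

lemma dyck_eq_forest_words: "dyck S = forest_word ` forests S"
proof (intro equalityI subsetI)
  fix w assume "w \<in> dyck S"
  then show "w \<in> forest_word ` forests S"
  proof induction
    case empty
    show ?case by (rule image_eqI[of _ _ "[]"]) (auto intro: forests.intros)
  next
    case (wrap \<alpha> w)
    then obtain us where "us \<in> forests S" "w = forest_word us" by auto
    with wrap show ?case
      by (intro image_eqI[of _ _ "[(\<alpha>, Node us)]"]) (auto intro: forests.intros)
  next
    case (append v w)
    then show ?case by (auto simp: forest_word_append[symmetric] intro: append_in_forests)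
  qed
next
  fix w assume "w \<in> forest_word ` forests S"
  then obtain ts where "ts \<in> forests S" "w = forest_word ts" by auto
  moreover from this(1) have "forest_word ts \<in> dyck S"
  proof induction
    case (Cons \<alpha> us ts)
    then show ?case using dyck.append[OF dyck.wrap[OF Cons(1) Cons(4)] Cons(5)] by simp
  qed (simp add: dyck.empty)
  ultimately show "w \<in> dyck S" by simp
qed

lemma tree_of_forest_word: "tree_of_word (forest_word ts) = Node ts"
  unfolding tree_of_word_def
proof (rule the_equality)
  show "word_tree (forest_word ts) (Node ts)" by (rule word_tree_forest_word_self)
  fix t assume "word_tree (forest_word ts) t"
  then show "t = Node ts"
    using word_tree_forest_word injD[OF inj_forest_word] by (metis ptree.exhaust)
qed

section \<open>Sums over the edges of a planar tree\<close>

lemma finite_tree_edges: "finite (tree_edges T)"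
  by (induction T rule: tree_edges.induct) auto

text \<open>The lower endpoint of every edge leading to or lying in the \<open>i\<close>-th branch
  starts with \<open>i\<close>, so different branches contribute disjoint edge sets. With arbitrary
  weights \<open>f\<close> this covers edge counts, dimensions and the detection of labels
  alike.\<close>

lemma sum_tree_edges_Node:
  fixes f :: "'a \<Rightarrow> 'b::comm_monoid_add"
  shows "(\<Sum>(u, v, \<alpha>)\<in>tree_edges (Node ts). f \<alpha>)
    = (\<Sum>(\<alpha>, T)\<leftarrow>ts. f \<alpha> + (\<Sum>(u, v, \<beta>)\<in>tree_edges T. f \<beta>))"
proof -
  let ?A = "\<lambda>i. (\<lambda>(u, v, \<alpha>). (i # u, i # v, \<alpha>)) ` tree_edges (snd (ts ! i))"
  have "(\<Sum>(u, v, \<alpha>)\<in>tree_edges (Node ts). f \<alpha>)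
    = (\<Sum>i<length ts. \<Sum>(u, v, \<alpha>)\<in>insert ([], [i], fst (ts ! i)) (?A i). f \<alpha>)"
    unfolding tree_edges.simps
    by (rule sum.UNION_disjoint) (auto simp: finite_tree_edges)
  also have "\<dots> = (\<Sum>i<length ts. (\<lambda>(\<alpha>, T). f \<alpha> + (\<Sum>(u, v, \<beta>)\<in>tree_edges T. f \<beta>)) (ts ! i))"
  proof (rule sum.cong[OF refl])
    fix i
    have "(\<Sum>(u, v, \<alpha>)\<in>?A i. f \<alpha>) = (\<Sum>(u, v, \<beta>)\<in>tree_edges (snd (ts ! i)). f \<beta>)"
      by (subst sum.reindex) (auto intro!: inj_onI sum.cong)
    then show "(\<Sum>(u, v, \<alpha>)\<in>insert ([], [i], fst (ts ! i)) (?A i). f \<alpha>)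
      = (\<lambda>(\<alpha>, T). f \<alpha> + (\<Sum>(u, v, \<beta>)\<in>tree_edges T. f \<beta>)) (ts ! i)"
      by (subst sum.insert) (auto simp: finite_tree_edges case_prod_beta)
  qed
  also have "\<dots> = (\<Sum>(\<alpha>, T)\<leftarrow>ts. f \<alpha> + (\<Sum>(u, v, \<beta>)\<in>tree_edges T. f \<beta>))"
    by (simp add: sum_list_sum_nth atLeast0LessThan)
  finally show ?thesis .
qed

lemma tree_edges_leaf [simp]: "tree_edges (Node []) = {}"
  by simp

section \<open>Rooted trees\<close>

text \<open>Growing a tree leaf by leaf suits splines: each step adds one vertex and one condition.
  The vertex type is abstract, so that no paths enter the linear algebra.\<close>

inductive rooted_tree :: "'v \<Rightarrow> 'v set \<Rightarrow> ('v \<times> 'v \<times> 'a) set \<Rightarrow> bool" for r where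
  root: "rooted_tree r {r} {}"
| leaf: "rooted_tree r V E \<Longrightarrow> u \<in> V \<Longrightarrow> v \<notin> V \<Longrightarrow> rooted_tree r (insert v V) (insert (u, v, \<alpha>) E)"

lemma rooted_tree_edgesD:
  "rooted_tree r V E \<Longrightarrow> finite E \<and> E \<subseteq> V \<times> V \<times> UNIV"
  by (induction rule: rooted_tree.induct) auto

lemma rooted_tree_image:
  assumes "rooted_tree r V E" "inj f"
  shows "rooted_tree (f r) (f ` V) ((\<lambda>(u, v, \<alpha>). (f u, f v, \<alpha>)) ` E)"
  using assms
proof induction
  case (leaf V E u v \<alpha>)
  then show ?case using rooted_tree.leaf[of "f r" "f ` V" _ "f u" "f v" \<alpha>] by (auto simp: inj_image_mem_iff)
qed (use rooted_tree.root in auto)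

text \<open>Repeat the growth of the second tree inside the first: its root \<open>s\<close> becomes
  a leaf below \<open>u\<close>, and the later leaves follow in the same order. Disjointness keeps
  each of them new.\<close>

lemma rooted_tree_attach:
  assumes T: "rooted_tree r V E" and "rooted_tree s W F" "V \<inter> W = {}" "u \<in> V"
  shows "rooted_tree r (V \<union> W) (insert (u, s, \<alpha>) (E \<union> F))"
  using assms(2-)
proof induction
  case root
  then show ?case using rooted_tree.leaf[OF T, of u s \<alpha>] by simp
next
  case (leaf W F x y \<beta>)
  then have "rooted_tree r (V \<union> W) (insert (u, s, \<alpha>) (E \<union> F))" by auto
  from rooted_tree.leaf[OF this, of x y \<beta>] leaf show ?case by (auto simp: insert_commute)
qed

lemma tree_vertices_snoc:
  "tree_vertices (Node (ts @ [(\<alpha>, T)])) = tree_vertices (Node ts) \<union> (\<lambda>u. length ts # u) ` tree_vertices T"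
  by (auto simp: lessThan_Suc nth_append)

lemma tree_edges_snoc:
  "tree_edges (Node (ts @ [(\<alpha>, T)])) = insert ([], [length ts], \<alpha>)
    (tree_edges (Node ts) \<union> (\<lambda>(u, v, \<beta>). (length ts # u, length ts # v, \<beta>)) ` tree_edges T)"
  by (auto simp: lessThan_Suc nth_append)

lemma rooted_tree_ptree: "rooted_tree [] (tree_vertices T) (tree_edges T)"
proof (induction T)
  case (Node ts)
  then show ?case
  \<comment> \<open>Branches are added on the right, because this leaves the paths to all earlier
    vertices unchanged.\<close>
  proof (induction ts rule: rev_induct)
    case Nil
    show ?case using rooted_tree.root by simp
  next
    case (snoc x ts)
    obtain \<alpha> T where x: "x = (\<alpha>, T)" by fastforce
    have "rooted_tree [] (tree_vertices T) (tree_edges T)"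
      using snoc.prems[of x T] by (simp add: x)
    from rooted_tree_image[OF this, of "\<lambda>u. length ts # u"]
    have T: "rooted_tree [length ts] ((\<lambda>u. length ts # u) ` tree_vertices T)
        ((\<lambda>(u, v, \<beta>). (length ts # u, length ts # v, \<beta>)) ` tree_edges T)"
      by simp
    have "rooted_tree [] (tree_vertices (Node ts)) (tree_edges (Node ts))"
      using snoc.prems by (intro snoc.IH) auto
    from rooted_tree_attach[OF this T, of "[]" \<alpha>]
    show ?case unfolding x tree_vertices_snoc tree_edges_snoc by auto
  qed
qed

declare tree_vertices.simps [simp del] tree_edges.simps [simp del]

section \<open>Generating functions of forests\<close>

lemma sum_tree_edges_Cons:
  fixes f :: "'a \<Rightarrow> 'b::comm_monoid_add"
  shows "(\<Sum>(u, v, \<beta>)\<in>tree_edges (Node ((\<alpha>, T) # ts)). f \<beta>)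
    = f \<alpha> + (\<Sum>(u, v, \<beta>)\<in>tree_edges T. f \<beta>) + (\<Sum>(u, v, \<beta>)\<in>tree_edges (Node ts). f \<beta>)"
  by (simp add: sum_tree_edges_Node)

lemma card_tree_edges_Cons:
  "card (tree_edges (Node ((\<alpha>, T) # ts)))
    = Suc (card (tree_edges T) + card (tree_edges (Node ts)))"
  using sum_tree_edges_Cons[where f = "\<lambda>_. 1::nat"] by (simp add: case_prod_beta)

definition forest_level :: "'a set \<Rightarrow> nat \<Rightarrow> ('a \<times> 'a ptree) list set" where
  "forest_level S m = {ts \<in> forests S. card (tree_edges (Node ts)) = m}"

lemma forest_level_0: "forest_level S 0 = {[]}"
proof -
  have "ts = []" if "ts \<in> forests S" "card (tree_edges (Node ts)) = 0" for ts
    using that by cases (auto simp: card_tree_edges_Cons)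
  then show ?thesis by (auto simp: forest_level_def forests.intros)
qed

text \<open>The first edge accounts for the successor; of the remaining \<open>m\<close> edges,
  \<open>i\<close> lie in the branch below it and \<open>m - i\<close> in the other
  branches.\<close>

lemma forest_level_Suc:
  "forest_level S (Suc m) = (\<lambda>(i, \<alpha>, us, ts). (\<alpha>, Node us) # ts) `
     (SIGMA i:{..m}. S \<times> forest_level S i \<times> forest_level S (m - i))" (is "?L = ?f ` ?B")
proof (intro equalityI subsetI)
  fix x assume x: "x \<in> ?L"
  then have "x \<in> forests S" by (simp add: forest_level_def)
  then obtain \<alpha> us ts where "x = (\<alpha>, Node us) # ts" "\<alpha> \<in> S" "us \<in> forests S" "ts \<in> forests S"
    using x by (cases rule: forests.cases) (auto simp: forest_level_def)
  with x show "x \<in> ?f ` ?B"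
    by (intro image_eqI[of _ _ "(card (tree_edges (Node us)), \<alpha>, us, ts)"])
       (auto simp: forest_level_def card_tree_edges_Cons)
qed (auto simp: forest_level_def card_tree_edges_Cons forests.intros)

lemma finite_forest_level:
  assumes "finite S"
  shows "finite (forest_level S m)"
proof (induction m rule: less_induct)
  case (less m)
  show ?case
  proof (cases m)
    case (Suc k)
    with less assms show ?thesis
      unfolding Suc forest_level_Suc by (intro finite_imageI finite_SigmaI) auto
  qed (simp add: forest_level_0)
qed

lemma sum_forest_level_Suc:
  assumes "finite S"
  shows "(\<Sum>ts\<in>forest_level S (Suc m). h ts)
    = (\<Sum>i\<le>m. \<Sum>\<alpha>\<in>S. \<Sum>us\<in>forest_level S i. \<Sum>ts\<in>forest_level S (m - i). h ((\<alpha>, Node us) # ts))"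
proof -
  \<comment> \<open>The index \<open>i\<close> is determined by the forest, being the number of
    edges of \<open>Node us\<close>.\<close>
  have "inj_on (\<lambda>(i, \<alpha>, us, ts). (\<alpha>, Node us) # ts)
      (SIGMA i:{..m}. S \<times> forest_level S i \<times> forest_level S (m - i))"
    by (rule inj_onI) (auto simp: forest_level_def)
  then have "(\<Sum>ts\<in>forest_level S (Suc m). h ts)
    = (\<Sum>(i, \<alpha>, us, ts)\<in>(SIGMA i:{..m}. S \<times> forest_level S i \<times> forest_level S (m - i)).
         h ((\<alpha>, Node us) # ts))"
    unfolding forest_level_Suc by (simp add: sum.reindex o_def split_def)
  also have "\<dots> = (\<Sum>i\<le>m. \<Sum>(\<alpha>, us, ts)\<in>S \<times> forest_level S i \<times> forest_level S (m - i).
         h ((\<alpha>, Node us) # ts))"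
    by (subst sum.Sigma[symmetric]) (auto simp: assms finite_forest_level)
  finally show ?thesis by (simp add: sum.cartesian_product split_def)
qed

definition forest_series :: "'a set \<Rightarrow> (('a \<times> 'a ptree) list \<Rightarrow> 'b) \<Rightarrow> 'b::comm_ring_1 fps" where
  "forest_series S h = Abs_fps (\<lambda>m. \<Sum>ts\<in>forest_level S m. h ts)"

text \<open>The first edge gives the factor \<open>fps_X\<close> and a choice of label; the branch
  below it and the other branches vary independently, whence the square. The summand 1 is the empty
  forest.\<close>

lemma forest_series_count:
  fixes S :: "'a set"
  assumes "finite S"
  defines "N \<equiv> forest_series S (\<lambda>_. 1 :: 'b::comm_ring_1)"
  shows "N = 1 + fps_X * (fps_const (of_nat (card S)) * N\<^sup>2)"
proof (rule fps_ext)
  fix m show "N $ m = (1 + fps_X * (fps_const (of_nat (card S)) * N\<^sup>2)) $ m"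
  proof (cases m)
    case (Suc k)
    have "N $ Suc k = of_nat (card S) * (\<Sum>i\<le>k. N $ i * N $ (k - i))"
      unfolding N_def forest_series_def fps_nth_Abs_fps sum_forest_level_Suc[OF assms(1)]
      by (simp add: sum_distrib_left mult_ac)
    also have "\<dots> = (fps_const (of_nat (card S)) * N\<^sup>2) $ k"
      unfolding fps_mult_left_const_nth by (simp add: fps_mult_nth power2_eq_square atLeast0AtMost)
    finally show ?thesis by (simp add: Suc)
  qed (simp add: N_def forest_series_def forest_level_0)
qed

lemma forest_series_additive:
  fixes f :: "'a \<Rightarrow> 'b::comm_ring_1"
  assumes "finite S"
    and "w [] = 0" and w_Cons: "\<And>\<alpha> us ts. w ((\<alpha>, Node us) # ts) = f \<alpha> + w us + w ts"
  defines "N \<equiv> forest_series S (\<lambda>_. 1)" and "W \<equiv> forest_series S w"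
  shows "W = fps_X * (fps_const (\<Sum>\<alpha>\<in>S. f \<alpha>) * N\<^sup>2 + 2 * fps_const (of_nat (card S)) * N * W)"
proof (rule fps_ext)
  fix m
  show "W $ m = (fps_X * (fps_const (\<Sum>\<alpha>\<in>S. f \<alpha>) * N\<^sup>2 + 2 * fps_const (of_nat (card S)) * N * W)) $ m"
  proof (cases m)
    case (Suc k)
    \<comment> \<open>The weights of the first edge, of the branch below it and of the other
      branches give one convolution each; the last two agree by commutativity.\<close>
    have "W $ Suc k = (\<Sum>i\<le>k. (\<Sum>\<alpha>\<in>S. f \<alpha>) * (N $ i * N $ (k - i))
        + of_nat (card S) * (W $ i * N $ (k - i)) + of_nat (card S) * (N $ i * W $ (k - i)))"
      unfolding N_def W_def forest_series_def fps_nth_Abs_fps sum_forest_level_Suc[OF assms(1)] w_Cons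
      by (simp add: sum.distrib sum_distrib_left sum_distrib_right algebra_simps)
    also have "\<dots> = (fps_const (\<Sum>\<alpha>\<in>S. f \<alpha>) * (N * N) + fps_const (of_nat (card S)) * (W * N)
        + fps_const (of_nat (card S)) * (N * W)) $ k"
      unfolding fps_add_nth fps_mult_left_const_nth
      by (simp add: fps_mult_nth sum.distrib sum_distrib_left atLeast0AtMost)
    also have "fps_const (\<Sum>\<alpha>\<in>S. f \<alpha>) * (N * N) + fps_const (of_nat (card S)) * (W * N) + fps_const (of_nat (card S)) * (N * W)
      = fps_const (\<Sum>\<alpha>\<in>S. f \<alpha>) * N\<^sup>2 + 2 * fps_const (of_nat (card S)) * N * W"
      by (simp add: power2_eq_square algebra_simps)
    finally show ?thesis by (simp add: Suc)
  qed (simp add: W_def forest_series_def forest_level_0 assms)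
qed

section \<open>Elimination and the quadratic equation\<close>

lemma weighted_series_identity:
  fixes N W H t s a D :: "'a::comm_ring_1"
  assumes N: "N = 1 + t * (s * N\<^sup>2)"
    and W: "W = t * (a * N\<^sup>2 + 2 * s * N * W)"
    and H: "H = D * N + W"
  shows "(1 - 2 * s * t * N) * (2 * s\<^sup>2 * t * H + (a - D * s))
    = a - 2 * s * t * a - D * s * (1 - 4 * s * t)"
proof -
  \<comment> \<open>The two sides differ by a combination of the equations for \<open>N\<close> and
    \<open>W\<close>, so nothing is divided. The equation for \<open>W\<close> replaces
    \<open>(1 - 2 * s * t * N) * W\<close> by \<open>t * a * N\<^sup>2\<close>, the one for
    \<open>N\<close> removes \<open>N\<^sup>2\<close>, and the terms linear in \<open>N\<close>
    cancel.\<close>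
  have "(1 - 2 * s * t * N) * (2 * s\<^sup>2 * t * H + (a - D * s))
    = a - 2 * s * t * a - D * s * (1 - 4 * s * t)
      + (4 * s\<^sup>2 * t * D - 2 * s * t * a) * (N - (1 + t * (s * N\<^sup>2)))
      + 2 * s\<^sup>2 * t * (W - t * (a * N\<^sup>2 + 2 * s * N * W))"
    by (simp add: H power2_eq_square algebra_simps)
  then show ?thesis using N W by simp
qed

lemma algebraic_fps_weighted_forests:
  fixes f :: "'a \<Rightarrow> rat"
  assumes "finite S"
  shows "algebraic_fps (forest_series S (\<lambda>ts. D + (\<Sum>(u, v, \<beta>)\<in>tree_edges (Node ts). f \<beta>)))"
    (is "algebraic_fps ?H")
proof -
  define N where "N = forest_series S (\<lambda>_. 1 :: rat)"
  define W where "W = forest_series S (\<lambda>ts. \<Sum>(u, v, \<beta>)\<in>tree_edges (Node ts). f \<beta>)"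
  define a where "a = (\<Sum>\<alpha>\<in>S. f \<alpha>)"
  define s :: rat where "s = of_nat (card S)"
  have N: "N = 1 + fps_X * (fps_const s * N\<^sup>2)"
    using forest_series_count[OF assms] by (simp add: N_def s_def)
  have W: "W = fps_X * (fps_const a * N\<^sup>2 + 2 * fps_const s * N * W)"
    unfolding N_def W_def s_def a_def
    by (rule forest_series_additive[OF assms]) (simp_all add: sum_tree_edges_Cons)
  have H: "?H = fps_const D * N + W"
    by (rule fps_ext) (simp add: N_def W_def forest_series_def sum.distrib)
  define \<Delta> where "\<Delta> = 1 - 2 * fps_const s * fps_X * N"
  define A where "A = fps_const a - 2 * fps_const s * fps_X * fps_const a
    - fps_const D * fps_const s * (1 - 4 * fps_const s * fps_X)"
  \<comment> \<open>Up to sign, \<open>\<Delta>\<close> is the derivative of the quadratic equation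
    for \<open>N\<close>, taken at its root, so its square is the discriminant.\<close>
  have \<Delta>: "\<Delta>\<^sup>2 = 1 - 4 * fps_const s * fps_X"
  proof -
    have "\<Delta>\<^sup>2 = 1 - 4 * fps_const s * fps_X * (N - fps_X * (fps_const s * N\<^sup>2))"
      by (simp add: \<Delta>_def power2_eq_square algebra_simps)
    moreover have "N - fps_X * (fps_const s * N\<^sup>2) = 1" by (subst (1) N) simp
    ultimately show ?thesis by simp
  qed
  have A: "\<Delta> * (2 * (fps_const s)\<^sup>2 * fps_X * ?H + (fps_const a - fps_const D * fps_const s)) = A"
    unfolding \<Delta>_def A_def by (rule weighted_series_identity[OF N W H])
  \<comment> \<open>Squaring removes \<open>\<Delta>\<close>, through which alone \<open>N\<close>
    still enters.\<close>
  have key: "(1 - 4 * fps_const s * fps_X) *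
      (2 * (fps_const s)\<^sup>2 * fps_X * ?H + (fps_const a - fps_const D * fps_const s))\<^sup>2 = A\<^sup>2"
    by (simp add: \<Delta>[symmetric] A[symmetric] power_mult_distrib)
  show ?thesis
  proof (cases "s = 0")
    \<comment> \<open>Here \<open>S\<close> is empty, so \<open>a\<close> vanishes too and the
      quadratic polynomial of the other case would be zero. Only the empty forest remains, and the
      series is the constant \<open>D\<close>.\<close>
    case True
    then have "?H = fps_const D" using N W H assms by (auto simp: s_def a_def)
    then show ?thesis unfolding algebraic_fps_def
      by (intro exI[of _ "[:[:- D:], 1:]"]) (simp add: map_poly_pCons)
  next
    case False
    \<comment> \<open>Polynomials in \<open>t\<close> that represent the series occurring in
      \<open>key\<close>. As a polynomial in \<open>x\<close>, the witness below is
      \<open>p * (q * x + r)\<^sup>2 - b\<^sup>2\<close>; its leading coefficient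
      \<open>p * q\<^sup>2\<close> is nonzero because \<open>s\<close> is.\<close>
    define p :: "rat poly" where "p = [:1, - 4 * s:]"
    define q :: "rat poly" where "q = [:0, 2 * s\<^sup>2:]"
    define r :: "rat poly" where "r = [:a - D * s:]"
    define b :: "rat poly" where "b = [:a, - 2 * s * a:] - [:D * s:] * p"
    have pq: "fps_of_poly p = 1 - 4 * fps_const s * fps_X" 
       "fps_of_poly q = 2 * (fps_const s)\<^sup>2 * fps_X"
       "fps_of_poly r = fps_const a - fps_const D * fps_const s"
       "fps_of_poly b = A"
      by (simp_all add: p_def q_def r_def b_def A_def fps_of_poly_simps fps_of_poly_pCons)
    have "p \<noteq> 0" "q \<noteq> 0" using False by (simp_all add: p_def q_def)
    show ?thesis unfolding algebraic_fps_def
    proof (intro exI[of _ "[:p * r\<^sup>2 - b\<^sup>2, 2 * p * q * r, p * q\<^sup>2:]"] conjI)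
      show "[:p * r\<^sup>2 - b\<^sup>2, 2 * p * q * r, p * q\<^sup>2:] \<noteq> 0"
        using \<open>p \<noteq> 0\<close> \<open>q \<noteq> 0\<close> by simp
      show "poly (map_poly fps_of_poly [:p * r\<^sup>2 - b\<^sup>2, 2 * p * q * r, p * q\<^sup>2:]) ?H = 0"
        using key unfolding pq[symmetric]
        by (simp add: map_poly_pCons fps_of_poly_simps power2_eq_square algebra_simps)
    qed
  qed
qed

section \<open>Dimensions in short exact sequences\<close>

lemma linear_mapI:
  assumes "vectorspace K V" "vectorspace K W" "T \<in> LinearCombinations.module_hom K V W"
  shows "linear_map K V W T"
  using assms unfolding linear_map_def mod_hom_def mod_hom_axioms_def vectorspace_def by auto

text \<open>Preimages \<open>C\<close> of generators of \<open>W\<close> and generators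
  \<open>D\<close> of the kernel together generate \<open>V\<close>: any \<open>v\<close> agrees
  with some element of the span of \<open>C\<close> up to the kernel. Rank-nullity presupposes that
  \<open>V\<close> is finite-dimensional, so this has to come first.\<close>

lemma (in linear_map) fin_dim_from_kernel:
  assumes surj: "T ` carrier V = carrier W" and "W.fin_dim" and ker: "vectorspace.fin_dim K (V.vs kerT)"
  shows "V.fin_dim"
proof -
  interpret Ker: vectorspace K "V.vs kerT" by (rule V.subspace_is_vs[OF kerT_is_subspace])
  obtain D where D: "finite D" "D \<subseteq> kerT" "Ker.span D = kerT"
    using ker unfolding Ker.fin_dim_def by auto
  obtain B where B: "finite B" "B \<subseteq> carrier W" "W.module.span B = carrier W"
    using \<open>W.fin_dim\<close> unfolding W.fin_dim_def by auto
  obtain C where C: "finite C" "C \<subseteq> carrier V" "B = T ` C"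
    using B surj by (metis finite_subset_image)
  have ker_V: "kerT \<subseteq> carrier V" by (auto simp: mod_hom.ker_def)
  have span_D: "V.module.span D = kerT"
    using D V.module.span_li_not_depend(1)[OF D(2)] kerT_is_subspace by auto
  have CD: "C \<union> D \<subseteq> carrier V" using C D ker_V by auto
  have "carrier V \<subseteq> V.module.span (C \<union> D)"
  proof
    fix v assume v: "v \<in> carrier V"
    have sub: "submodule K (V.module.span C) V" using C by (simp add: V.module.span_is_submodule)
    \<comment> \<open>\<open>T\<close> is restricted to the span of \<open>C\<close> so that the
      image of this span is a submodule of \<open>W\<close>; it contains the generators
      \<open>B\<close>, hence everything.\<close>
    interpret C: linear_map K "V.vs (V.module.span C)" W T
    proof (rule linear_mapI)
      show "vectorspace K (V.vs (V.module.span C))"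
        using V.span_is_subspace C V.subspace_is_vs by blast
      show "vectorspace K W" by unfold_locales
      show "T \<in> LinearCombinations.module_hom K (V.vs (V.module.span C)) W"
        using T_hom V.module.span_is_subset2[OF C(2)]
        by (simp add: LinearCombinations.module_hom_def Pi_iff subset_iff)
    qed
    have "B \<subseteq> T ` V.module.span C" using C V.module.in_own_span by auto
    moreover have "submodule K (T ` V.module.span C) W" using C.im_is_submodule by (simp add: C.im_def)
    ultimately have "W.module.span B \<subseteq> T ` V.module.span C" by (rule W.module.span_is_subset)
    then obtain c where c: "c \<in> V.module.span C" "T v = T c" using B v by auto
    then have cV: "c \<in> carrier V" using C V.module.span_is_subset2 by blast
    then have "v \<ominus>\<^bsub>V\<^esub> c \<in> kerT" using v c by (simp add: mod_hom.ker_def)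
    then have "v \<ominus>\<^bsub>V\<^esub> c \<in> V.module.span (C \<union> D)"
      using span_D V.module.span_is_monotone[of D "C \<union> D"] by auto
    moreover have "c \<in> V.module.span (C \<union> D)" using c V.module.span_is_monotone[of C "C \<union> D"] by auto
    ultimately have "(v \<ominus>\<^bsub>V\<^esub> c) \<oplus>\<^bsub>V\<^esub> c \<in> V.module.span (C \<union> D)" using V.span_add1[OF CD] by blast
    then show "v \<in> V.module.span (C \<union> D)" using v cV by (simp add: a_minus_def V.module.M.a_assoc V.module.M.l_neg)
  qed
  then show ?thesis unfolding V.fin_dim_def
    using CD C D V.module.span_is_subset2[OF CD] by (intro exI[of _ "C \<union> D"]) auto
qed

text \<open>Rank-nullity for \<open>p\<close>, whose kernel is isomorphic to \<open>U\<close>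
  through \<open>i\<close> and whose image is all of \<open>W\<close>.\<close>

lemma dim_short_exact:
  assumes i: "linear_map K U V i" "inj_on i (carrier U)"
    and p: "linear_map K V W p" "p ` carrier V = carrier W"
    and exact: "i ` carrier U = {v \<in> carrier V. p v = \<zero>\<^bsub>W\<^esub>}"
    and U: "vectorspace.fin_dim K U" and W: "vectorspace.fin_dim K W"
  shows "vectorspace.fin_dim K V"
    and "vectorspace.dim K V = vectorspace.dim K U + vectorspace.dim K W"
proof -
  interpret i: linear_map K U V i by fact
  interpret p: linear_map K V W p by fact
  have ker: "p.kerT = i ` carrier U" by (simp add: exact p.ker_def)
  interpret Ker: vectorspace K "V\<lparr>carrier := p.kerT\<rparr>" 
    using p(1) p.kerT_is_subspace by (auto simp: linear_map_def intro: vectorspace.subspace_is_vs)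
  have "linear_map K U (V\<lparr>carrier := p.kerT\<rparr>) i"
  proof (rule linear_mapI)
    show "vectorspace K U" using i(1) by (simp add: linear_map_def)
    show "vectorspace K (V\<lparr>carrier := p.kerT\<rparr>)" ..
    show "i \<in> LinearCombinations.module_hom K U (V\<lparr>carrier := p.kerT\<rparr>)"
      using i.T_hom unfolding ker LinearCombinations.module_hom_def by auto
  qed
  then interpret j: linear_map K U "V\<lparr>carrier := p.kerT\<rparr>" i .
  have surj: "i ` carrier U = carrier (V\<lparr>carrier := p.kerT\<rparr>)" by (simp add: ker)
  show V: "vectorspace.fin_dim K V"
    by (rule p.fin_dim_from_kernel[OF p(2) W j.image_fin_dim[OF U surj]])
  have "W\<lparr>carrier := p.imT\<rparr> = W" by (simp add: p.im_def p(2))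
  then show "vectorspace.dim K V = vectorspace.dim K U + vectorspace.dim K W"
    using p.rank_nullity[OF V] j.dim_eq[OF U i(2) surj] by simp
qed

text \<open>An independent subset of \<open>W\<close> is independent in the whole space, which
  bounds its cardinality by \<open>dim\<close>. Hence a maximal one exists, and it generates
  \<open>W\<close>.\<close>

lemma (in vectorspace) fin_dim_subspace:
  assumes "fin_dim" and W: "VectorSpace.subspace K W V"
  shows "vectorspace.fin_dim K (vs W)"
proof -
  interpret W: vectorspace K "vs W" by (rule subspace_is_vs[OF W])
  have W_V: "W \<subseteq> carrier V" using W by (auto simp: VectorSpace.subspace_def submodule_def)
  define P where "P A \<longleftrightarrow> A \<subseteq> carrier (vs W) \<and> W.lin_indpt A" for A
  have "P {}" by (auto simp: P_def W.lin_dep_def)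
  moreover have "finite A \<and> card A \<le> dim" if "P A" for A
  proof -
    have "lin_indpt A" using that span_li_not_depend(2)[of A W] W by (auto simp: P_def VectorSpace.subspace_def)
    then show ?thesis using li_le_dim[OF \<open>fin_dim\<close>, of A] that W_V by (auto simp: P_def)
  qed
  ultimately obtain A where "finite A" "maximal A P" using maximal_exists by blast
  then show ?thesis
    using W.max_li_is_gen[of A] unfolding W.fin_dim_def P_def maximal_def by auto
qed

section \<open>Splines on rooted trees\<close>

lemma module_homI:
  assumes "\<And>x. x \<in> carrier M \<Longrightarrow> f x \<in> carrier N"
    and "\<And>x y. x \<in> carrier M \<Longrightarrow> y \<in> carrier M \<Longrightarrow> f (x \<oplus>\<^bsub>M\<^esub> y) = f x \<oplus>\<^bsub>N\<^esub> f y"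
    and "\<And>a x. a \<in> carrier R \<Longrightarrow> x \<in> carrier M \<Longrightarrow> f (a \<odot>\<^bsub>M\<^esub> x) = a \<odot>\<^bsub>N\<^esub> f x"
  shows "f \<in> LinearCombinations.module_hom R M N"
  using assms by (simp add: LinearCombinations.module_hom_def)

lemma in_carrier_Spl: "p \<in> carrier (Spl R V E) \<longleftrightarrow>
    p \<in> V \<rightarrow>\<^sub>E carrier R \<and> (\<forall>(u, v, I)\<in>E. p u \<ominus>\<^bsub>R\<^esub> p v \<in> I)"
  by (simp add: Spl_def)

lemma Spl_simps [simp]:
  "\<zero>\<^bsub>Spl R V E\<^esub> = (\<lambda>v\<in>V. \<zero>\<^bsub>R\<^esub>)"
  "p \<oplus>\<^bsub>Spl R V E\<^esub> q = (\<lambda>v\<in>V. p v \<oplus>\<^bsub>R\<^esub> q v)"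
  "r \<odot>\<^bsub>Spl R V E\<^esub> p = (\<lambda>v\<in>V. r \<otimes>\<^bsub>R\<^esub> p v)"
  by (simp_all add: Spl_def)

text \<open>The choice \<open>I = carrier R\<close> gives \<open>R\<close> as a module over
  itself.\<close>

definition ideal_module :: "('r, 'b) ring_scheme \<Rightarrow> 'r set \<Rightarrow> ('r, 'r) module" where
  "ideal_module R I = \<lparr>carrier = I, monoid.mult = monoid.mult R, monoid.one = monoid.one R,
     ring.zero = ring.zero R, ring.add = ring.add R, module.smult = monoid.mult R\<rparr>"

lemma ideal_module_simps [simp]:
  "carrier (ideal_module R I) = I"
  "\<zero>\<^bsub>ideal_module R I\<^esub> = \<zero>\<^bsub>R\<^esub>"
  "x \<oplus>\<^bsub>ideal_module R I\<^esub> y = x \<oplus>\<^bsub>R\<^esub> y"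
  "r \<odot>\<^bsub>ideal_module R I\<^esub> x = r \<otimes>\<^bsub>R\<^esub> x"
  by (simp_all add: ideal_module_def)

lemma module_ideal_module:
  assumes "cring R" "ideal I R"
  shows "Module.module R (ideal_module R I)"
proof -
  interpret cring R by fact
  interpret ideal I R by fact
  show ?thesis
    by (rule module_criteria)
       (auto simp: ideal_module_def is_cring a_ac m_assoc l_distr r_distr I_l_closed
         intro!: bexI[of _ "\<ominus>\<^bsub>R\<^esub> _"] r_neg)
qed

text \<open>Each condition survives the pointwise operations because its label is an ideal. The
  endpoints are taken in \<open>V\<close> since \<open>restrict\<close> makes sums and multiples
  \<open>undefined\<close> elsewhere.\<close>

lemma module_Spl:
  assumes "cring R" and ideals: "\<And>u v I. (u, v, I) \<in> E \<Longrightarrow> ideal I R"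
    and E: "E \<subseteq> V \<times> V \<times> UNIV"
  shows "Module.module R (Spl R V E)"
proof -
  interpret cring R by fact
  have minus: "(\<ominus>\<^bsub>R\<^esub> a) \<ominus>\<^bsub>R\<^esub> (\<ominus>\<^bsub>R\<^esub> b) = \<ominus>\<^bsub>R\<^esub> (a \<ominus>\<^bsub>R\<^esub> b)"
    if "a \<in> carrier R" "b \<in> carrier R" for a b using that by algebra
  have add: "(a \<oplus>\<^bsub>R\<^esub> b) \<ominus>\<^bsub>R\<^esub> (c \<oplus>\<^bsub>R\<^esub> d) = (a \<ominus>\<^bsub>R\<^esub> c) \<oplus>\<^bsub>R\<^esub> (b \<ominus>\<^bsub>R\<^esub> d)"
    if "a \<in> carrier R" "b \<in> carrier R" "c \<in> carrier R" "d \<in> carrier R" for a b c d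
    using that by algebra
  have mult: "(a \<otimes>\<^bsub>R\<^esub> b) \<ominus>\<^bsub>R\<^esub> (a \<otimes>\<^bsub>R\<^esub> c) = a \<otimes>\<^bsub>R\<^esub> (b \<ominus>\<^bsub>R\<^esub> c)"
    if "a \<in> carrier R" "b \<in> carrier R" "c \<in> carrier R" for a b c using that by algebra
  have closed: "(\<lambda>w\<in>V. f w) \<in> carrier (Spl R V E)"
    if "\<And>w. w \<in> V \<Longrightarrow> f w \<in> carrier R" "\<And>u v I. (u, v, I) \<in> E \<Longrightarrow> f u \<ominus>\<^bsub>R\<^esub> f v \<in> I" for f
    using that E by (fastforce simp: in_carrier_Spl)
  have mem: "w \<in> V \<Longrightarrow> p w \<in> carrier R" "(u, v, I) \<in> E \<Longrightarrow> p u \<ominus>\<^bsub>R\<^esub> p v \<in> I"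
      "(\<lambda>w\<in>V. p w) = p" if "p \<in> carrier (Spl R V E)" for p u v w I
    using that by (auto simp: in_carrier_Spl PiE_restrict)
  have E_V: "u \<in> V" "v \<in> V" if "(u, v, I) \<in> E" for u v I
    using that E by auto
  have subgroup: "additive_subgroup I R" if "(u, v, I) \<in> E" for u v I
    using ideals[OF that] by (rule ideal.axioms)
  show ?thesis
  proof (rule module_criteria; (intro ballI allI impI; (elim conjE)?)?)
    show "cring R" by fact
    show "\<zero>\<^bsub>Spl R V E\<^esub> \<in> carrier (Spl R V E)" unfolding Spl_simps
      by (rule closed) (auto simp: a_minus_def dest: subgroup additive_subgroup.zero_closed)
  next
    fix p q assume pq: "p \<in> carrier (Spl R V E)" "q \<in> carrier (Spl R V E)"
    show "p \<oplus>\<^bsub>Spl R V E\<^esub> q \<in> carrier (Spl R V E)" unfolding Spl_simps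
    proof (rule closed)
      fix u v I assume e: "(u, v, I) \<in> E"
      from additive_subgroup.a_closed[OF subgroup[OF e] mem(2)[OF pq(1) e] mem(2)[OF pq(2) e]]
      show "(p u \<oplus>\<^bsub>R\<^esub> q u) \<ominus>\<^bsub>R\<^esub> (p v \<oplus>\<^bsub>R\<^esub> q v) \<in> I"
        using pq E_V[OF e] by (simp add: add mem)
    qed (use pq in \<open>simp add: mem\<close>)
  next
    fix p assume p: "p \<in> carrier (Spl R V E)"
    have "(\<lambda>w\<in>V. \<ominus>\<^bsub>R\<^esub> p w) \<in> carrier (Spl R V E)"
    proof (rule closed)
      fix u v I assume e: "(u, v, I) \<in> E"
      from additive_subgroup.a_inv_closed[OF subgroup[OF e] mem(2)[OF p e]]
      show "(\<ominus>\<^bsub>R\<^esub> p u) \<ominus>\<^bsub>R\<^esub> (\<ominus>\<^bsub>R\<^esub> p v) \<in> I"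
        using p E_V[OF e] by (simp add: minus mem)
    qed (use p in \<open>simp add: mem\<close>)
    then show "\<exists>q\<in>carrier (Spl R V E). p \<oplus>\<^bsub>Spl R V E\<^esub> q = \<zero>\<^bsub>Spl R V E\<^esub>"
      by (rule bexI[rotated]) (use p in \<open>auto simp: mem r_neg intro!: restrict_ext\<close>)
  next
    fix a p assume a: "a \<in> carrier R" and p: "p \<in> carrier (Spl R V E)"
    show "a \<odot>\<^bsub>Spl R V E\<^esub> p \<in> carrier (Spl R V E)" unfolding Spl_simps
    proof (rule closed)
      fix u v I assume e: "(u, v, I) \<in> E"
      from ideal.I_l_closed[OF ideals[OF e] mem(2)[OF p e] a]
      show "(a \<otimes>\<^bsub>R\<^esub> p u) \<ominus>\<^bsub>R\<^esub> (a \<otimes>\<^bsub>R\<^esub> p v) \<in> I"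
        using a p E_V[OF e] by (simp add: mult mem)
    qed (use a p in \<open>simp add: mem\<close>)
  next
    fix p assume p: "p \<in> carrier (Spl R V E)"
    then have "p = (\<lambda>w\<in>V. p w)" by (simp add: mem)
    with p show "p \<oplus>\<^bsub>Spl R V E\<^esub> \<zero>\<^bsub>Spl R V E\<^esub> = p" and "\<one>\<^bsub>R\<^esub> \<odot>\<^bsub>Spl R V E\<^esub> p = p"
      by (auto simp: mem cong: restrict_cong)
  qed (auto simp: mem a_ac m_assoc l_distr r_distr intro!: restrict_ext)
qed

lemma module_restrict_scalars:
  assumes "Module.module R M" "\<phi> \<in> Ring.ring_hom K R" "cring K"
  shows "Module.module K (restrict_scalars \<phi> M)"
proof -
  interpret Module.module R M by fact
  have \<phi>: "a \<in> carrier K \<Longrightarrow> \<phi> a \<in> carrier R" for a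
    using assms(2) by (rule ring_hom_closed)
  show ?thesis
    by (rule module_criteria)
       (use assms(2,3) \<phi> M.a_inv_closed in
         \<open>auto simp: restrict_scalars_def ring_hom_mult ring_hom_add ring_hom_one M.a_ac smult_assoc1
           smult_l_distr smult_r_distr intro!: bexI[of _ "\<ominus>\<^bsub>M\<^esub> _"] M.r_neg\<close>)
qed

lemma module_hom_restrict_scalars:
  assumes "f \<in> LinearCombinations.module_hom R M N" "\<phi> \<in> Ring.ring_hom K R"
  shows "f \<in> LinearCombinations.module_hom K (restrict_scalars \<phi> M) (restrict_scalars \<phi> N)"
  using assms ring_hom_closed[OF assms(2)]
  by (simp add: LinearCombinations.module_hom_def restrict_scalars_def)

section \<open>Dimensions of spline modules over a field\<close>

locale field_algebra = R: cring R + K: field K for R (structure) and K +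
  fixes \<phi>
  assumes scalar_hom: "\<phi> \<in> Ring.ring_hom K R"
begin

abbreviation "fin_dim_over M \<equiv> vectorspace.fin_dim K (restrict_scalars \<phi> M)"
abbreviation "dim_over M \<equiv> vectorspace.dim K (restrict_scalars \<phi> M)"

lemma vectorspace_restrict_scalars: "Module.module R M \<Longrightarrow> vectorspace K (restrict_scalars \<phi> M)"
  by (simp add: vectorspace_def module_restrict_scalars scalar_hom K.field_axioms K.is_cring)

lemma linear_map_restrict_scalars:
  assumes "Module.module R M" "Module.module R N" "f \<in> LinearCombinations.module_hom R M N"
  shows "linear_map K (restrict_scalars \<phi> M) (restrict_scalars \<phi> N) f"
  using assms by (intro linear_mapI[OF _ _ module_hom_restrict_scalars[OF assms(3) scalar_hom]]
      vectorspace_restrict_scalars)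

text \<open>Scalars of \<open>K\<close> act through \<open>\<phi>\<close>, that is, by
  multiplication in \<open>R\<close>, so an ideal is a subspace of \<open>R\<close>.\<close>

lemma fin_dim_ideal:
  assumes R: "fin_dim_over (ideal_module R (carrier R))" and I: "ideal I R"
  shows "fin_dim_over (ideal_module R I)"
proof -
  let ?V = "restrict_scalars \<phi> (ideal_module R (carrier R))"
  interpret V: vectorspace K ?V
    by (intro vectorspace_restrict_scalars module_ideal_module R.is_cring R.oneideal)
  interpret ideal I R by fact
  have eq: "V.vs I = restrict_scalars \<phi> (ideal_module R I)"
    by (simp add: restrict_scalars_def ideal_module_def)
  have "VectorSpace.subspace K I ?V"
    unfolding VectorSpace.subspace_def
  proof
    show "vectorspace K ?V" ..
    show "LinearCombinations.submodule K I ?V"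
      using V.module_axioms I_l_closed ring_hom_closed[OF scalar_hom]
      by unfold_locales (auto simp: restrict_scalars_def ideal_module_def)
  qed
  from V.fin_dim_subspace[OF R this] show ?thesis by (simp add: eq)
qed

text \<open>Forgetting the value at the new leaf gives a short exact sequence from \<open>I\<close>
  through the larger spline module onto the smaller one. A spline in the kernel vanishes on
  \<open>V\<close>, so the new edge says exactly that its value at \<open>v\<close> lies in
  \<open>I\<close>.\<close>

lemma dim_Spl_leaf:
  fixes V :: "'v set"
  assumes ideals: "\<And>u v I. (u, v, I) \<in> E \<Longrightarrow> ideal I R" and E: "E \<subseteq> V \<times> V \<times> UNIV"
    and I: "ideal I R" and uv: "u \<in> V" "v \<notin> V"
    and fin: "fin_dim_over (ideal_module R I)" "fin_dim_over (Spl R V E)"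
  defines "M \<equiv> Spl R (insert v V) (insert (u, v, I) E)"
  shows "fin_dim_over M" and "dim_over M = dim_over (ideal_module R I) + dim_over (Spl R V E)"
proof -
  define i where "i x = (\<lambda>w\<in>insert v V. if w = v then x else \<zero>)" for x
  define p where "p q = restrict q V" for q :: "'v \<Rightarrow> 'a"
  interpret I: ideal I R by fact
  have mods: "Module.module R (ideal_module R I)" "Module.module R M" "Module.module R (Spl R V E)"
    using ideals E I uv unfolding M_def
    by (intro module_ideal_module module_Spl R.is_cring; fastforce)+
  interpret Spl: Module.module R "Spl R V E" by fact
  have E_V: "a \<in> V" "b \<in> V" "a \<noteq> v" "b \<noteq> v" if "(a, b, J) \<in> E" for a b J
    using that E uv by auto
  have zero_in: "\<zero> \<in> J" if "(a, b, J) \<in> E" for a b J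
    using ideals[OF that] by (simp add: additive_subgroup.zero_closed ideal.axioms(1))
  \<comment> \<open>No old edge meets \<open>v\<close>, so the conditions separate into the one for
    the new edge and those on the restriction to \<open>V\<close>.\<close>
  have M: "q \<in> carrier M \<longleftrightarrow> q \<in> insert v V \<rightarrow>\<^sub>E carrier R \<and> q u \<ominus> q v \<in> I \<and>
      restrict q V \<in> carrier (Spl R V E)" for q
    using E_V uv by (fastforce simp: M_def Spl_def)
  have i_M: "i x \<in> carrier M" if "x \<in> I" for x
  proof -
    have "\<zero> \<ominus> x \<in> I" using that I.Icarr by (simp add: a_minus_def)
    moreover have "restrict (i x) V = (\<lambda>w\<in>V. \<zero>)" using uv by (auto simp: i_def intro!: restrict_ext)
    moreover have "(\<lambda>w\<in>V. \<zero>) \<in> carrier (Spl R V E)"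
      using Spl.M.zero_closed by simp
    ultimately show ?thesis using that uv I.Icarr unfolding M by (auto simp: i_def)
  qed
  have i_hom: "i \<in> LinearCombinations.module_hom R (ideal_module R I) M"
    by (rule module_homI) (auto simp: i_M, auto simp: M_def i_def intro!: restrict_ext)
  have p_hom: "p \<in> LinearCombinations.module_hom R M (Spl R V E)"
    by (rule module_homI) (auto simp: M p_def, auto simp: M_def intro!: restrict_ext)
  have surj: "p ` carrier M = carrier (Spl R V E)"
  proof (intro equalityI subsetI)
    fix q assume q: "q \<in> carrier (Spl R V E)"
    \<comment> \<open>Copying the value at \<open>u\<close> to \<open>v\<close> makes the difference
      along the new edge zero.\<close>
    define q' where "q' = (\<lambda>w\<in>insert v V. if w = v then q u else q w)"
    have res: "restrict q' V = q" using q uv by (auto simp: q'_def Spl_def intro!: ext)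
    have "q u \<in> carrier R" using q uv by (auto simp: in_carrier_Spl)
    then have "q' \<in> carrier M"
      using q uv by (auto simp: M res) (auto simp: q'_def in_carrier_Spl a_minus_def R.r_neg split: if_splits)
    then show "q \<in> p ` carrier M" using res by (auto simp: p_def)
  qed (use M in \<open>auto simp: p_def\<close>)
  have exact: "i ` I = {q \<in> carrier M. p q = \<zero>\<^bsub>Spl R V E\<^esub>}"
  proof (intro equalityI subsetI)
    fix q assume "q \<in> {q \<in> carrier M. p q = \<zero>\<^bsub>Spl R V E\<^esub>}"
    then have q: "q \<in> insert v V \<rightarrow>\<^sub>E carrier R" "q u \<ominus> q v \<in> I" and "restrict q V = (\<lambda>w\<in>V. \<zero>)"
      by (auto simp: M p_def)
    then have q0: "q w = \<zero>" if "w \<in> V" for w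
      using that by (metis restrict_apply')
    have "\<ominus> (q u \<ominus> q v) \<in> I" using q by simp
    moreover have "q v \<in> carrier R" using q(1) by auto
    ultimately have "q v \<in> I" using q0[OF uv(1)] by (simp add: a_minus_def)
    moreover have "q = i (q v)" using q q0 by (auto simp: i_def intro!: ext)
    ultimately show "q \<in> i ` I" by blast
  qed (use i_M uv in \<open>auto simp: p_def\<close>, use uv in \<open>auto simp: i_def intro!: restrict_ext\<close>)
  have inj: "inj_on i I"
    by (rule inj_onI) (drule fun_cong[of _ _ v], simp add: i_def)
  have sel: "carrier (restrict_scalars \<phi> (ideal_module R I)) = I"
     "carrier (restrict_scalars \<phi> N) = carrier N" "\<zero>\<^bsub>restrict_scalars \<phi> N\<^esub> = \<zero>\<^bsub>N\<^esub>" for N :: "('a, 'v \<Rightarrow> 'a) module"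
    by (simp_all add: restrict_scalars_def ideal_module_def)
  note * = dim_short_exact[OF linear_map_restrict_scalars[OF mods(1,2) i_hom] _
     linear_map_restrict_scalars[OF mods(2,3) p_hom], unfolded sel, OF inj surj exact fin]
  show "fin_dim_over M" "dim_over M = dim_over (ideal_module R I) + dim_over (Spl R V E)"
    by (rule *)+
qed

lemma dim_Spl_root:
  assumes "fin_dim_over (ideal_module R (carrier R))"
  shows "fin_dim_over (Spl R {r} {})" and "dim_over (Spl R {r} {}) = dim_over (ideal_module R (carrier R))"
proof -
  define i where "i x = (\<lambda>w\<in>{r}. x)" for x :: 'a
  have "i \<in> LinearCombinations.module_hom R (ideal_module R (carrier R)) (Spl R {r} {})"
    by (auto simp: LinearCombinations.module_hom_def i_def in_carrier_Spl intro!: restrict_ext)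
  then interpret linear_map K "restrict_scalars \<phi> (ideal_module R (carrier R))"
      "restrict_scalars \<phi> (Spl R {r} {})" i
    by (intro linear_map_restrict_scalars module_ideal_module module_Spl R.is_cring R.oneideal) auto
  have inj: "inj_on i (carrier (restrict_scalars \<phi> (ideal_module R (carrier R))))"
    by (rule inj_onI) (drule fun_cong[of _ _ r], simp add: i_def)
  have surj: "i ` carrier (restrict_scalars \<phi> (ideal_module R (carrier R)))
      = carrier (restrict_scalars \<phi> (Spl R {r} {}))"
  proof (intro equalityI subsetI)
    fix q assume "q \<in> carrier (restrict_scalars \<phi> (Spl R {r} {}))"
    then show "q \<in> i ` carrier (restrict_scalars \<phi> (ideal_module R (carrier R)))"
      by (intro image_eqI[of _ _ "q r"])
         (auto simp: restrict_scalars_def in_carrier_Spl i_def intro!: ext)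
  qed (auto simp: restrict_scalars_def in_carrier_Spl i_def split: if_splits)
  show "fin_dim_over (Spl R {r} {})" by (rule image_fin_dim[OF assms surj])
  show "dim_over (Spl R {r} {}) = dim_over (ideal_module R (carrier R))"
    using dim_eq[OF assms inj surj] by simp
qed

text \<open>Induction along the growth of the tree: the root contributes a copy of \<open>R\<close>,
  and each leaf contributes the ideal on its edge.\<close>

theorem dim_Spl_rooted_tree:
  assumes "rooted_tree r V E" and "fin_dim_over (ideal_module R (carrier R))"
    and "\<And>u v I. (u, v, I) \<in> E \<Longrightarrow> ideal I R"
  shows "fin_dim_over (Spl R V E) \<and> dim_over (Spl R V E)
    = dim_over (ideal_module R (carrier R)) + (\<Sum>(u, v, I)\<in>E. dim_over (ideal_module R I))"
  using assms(1,3)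
proof induction
  case root
  show ?case using dim_Spl_root[OF assms(2), of r] by simp
next
  case (leaf V E u v I)
  have E: "finite E" "E \<subseteq> V \<times> V \<times> UNIV" using rooted_tree_edgesD[OF leaf.hyps(1)] by auto
  have IH: "fin_dim_over (Spl R V E)" "dim_over (Spl R V E)
    = dim_over (ideal_module R (carrier R)) + (\<Sum>(u, v, I)\<in>E. dim_over (ideal_module R I))"
    using leaf by auto
  have ideals: "ideal I R" "\<And>u v J. (u, v, J) \<in> E \<Longrightarrow> ideal J R" using leaf.prems by auto
  \<comment> \<open>The edge is new because \<open>v\<close> is, so the sum over edges gains exactly
    one term even if the label \<open>I\<close> occurs already.\<close>
  have "(u, v, I) \<notin> E" using E leaf.hyps by auto
  with dim_Spl_leaf[OF ideals(2) E(2) ideals(1) leaf.hyps(2,3) fin_dim_ideal[OF assms(2) ideals(1)] IH(1)] IH(2) E(1)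
  show ?case by simp
qed

end

section \<open>Truncated polynomial rings\<close>

definition monomials :: "nat \<Rightarrow> (nat \<Rightarrow>\<^sub>0 nat) set" where
  "monomials n = {m. Poly_Mapping.keys m \<subseteq> {..<n}}"

lemma zero_in_monomials: "0 \<in> monomials n"
  by (simp add: monomials_def)

lemma add_in_monomials: "m \<in> monomials n \<Longrightarrow> m' \<in> monomials n \<Longrightarrow> m + m' \<in> monomials n"
  using Poly_Mapping.keys_add[of m m'] by (auto simp: monomials_def)

definition mdegree :: "(nat \<Rightarrow>\<^sub>0 nat) \<Rightarrow> nat" where
  "mdegree m = (\<Sum>i\<in>Poly_Mapping.keys m. Poly_Mapping.lookup m i)"

lemma carrier_poly_ring:
  "carrier (poly_ring n) = {p :: 'k::field mpoly. Poly_Mapping.keys p \<subseteq> monomials n}"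
  by (auto simp: poly_ring_def monomials_def)

lemma poly_ring_simps [simp]:
  "p \<oplus>\<^bsub>poly_ring n\<^esub> q = p + q" "p \<otimes>\<^bsub>poly_ring n\<^esub> q = p * q"
  "\<zero>\<^bsub>poly_ring n\<^esub> = 0" "\<one>\<^bsub>poly_ring n\<^esub> = 1"
  by (simp_all add: poly_ring_def)

lemma cring_poly_ring: "cring (poly_ring n :: 'k::field mpoly ring)"
proof (rule cringI)
  show "abelian_group (poly_ring n :: 'k mpoly ring)"
  proof (rule abelian_groupI)
    fix p q :: "'k mpoly" assume "p \<in> carrier (poly_ring n)" "q \<in> carrier (poly_ring n)"
    then show "p \<oplus>\<^bsub>poly_ring n\<^esub> q \<in> carrier (poly_ring n)"
      using Poly_Mapping.keys_add[of p q] by (auto simp: carrier_poly_ring)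
  next
    fix p :: "'k mpoly" assume "p \<in> carrier (poly_ring n)"
    then show "\<exists>q\<in>carrier (poly_ring n). q \<oplus>\<^bsub>poly_ring n\<^esub> p = \<zero>\<^bsub>poly_ring n\<^esub>"
      by (intro bexI[of _ "- p"]) (auto simp: carrier_poly_ring)
  qed (auto simp: carrier_poly_ring algebra_simps)
next
  show "comm_monoid (poly_ring n :: 'k mpoly ring)"
  proof (rule comm_monoidI)
    fix p q :: "'k mpoly" assume "p \<in> carrier (poly_ring n)" "q \<in> carrier (poly_ring n)"
    then show "p \<otimes>\<^bsub>poly_ring n\<^esub> q \<in> carrier (poly_ring n)"
      using Poly_Mapping.keys_mult[of p q] by (fastforce simp: carrier_poly_ring intro: add_in_monomials)
  qed (auto simp: carrier_poly_ring zero_in_monomials mult_ac)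
qed (auto simp: algebra_simps)

lemma ideal_var_ideal: "ideal (var_ideal n) (poly_ring n)"
proof -
  interpret cring "poly_ring n" by (rule cring_poly_ring)
  show ?thesis unfolding var_ideal_def
    by (rule genideal_ideal) (auto simp: mvar_def carrier_poly_ring monomials_def)
qed

lemma ideal_var_ideal_power: "ideal (var_ideal_power n d) (poly_ring n)"
proof -
  interpret cring "poly_ring n" by (rule cring_poly_ring)
  interpret ideals: comm_monoid "ideals_set (poly_ring n)" by (rule ideals_set_is_comm_monoid)
  have "var_ideal_power n d \<in> carrier (ideals_set (poly_ring n))"
    unfolding var_ideal_power_def
    by (rule ideals.nat_pow_closed) (simp add: ideals_set_def ideal_var_ideal)
  then show ?thesis by (simp add: ideals_set_def)
qed

lemma var_ideal_power_Suc:
  "p \<in> var_ideal_power n d \<Longrightarrow> q \<in> var_ideal n \<Longrightarrow> p * q \<in> var_ideal_power n (Suc d)"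
proof -
  interpret cring "poly_ring n" by (rule cring_poly_ring)
  interpret ideals: comm_monoid "ideals_set (poly_ring n)" by (rule ideals_set_is_comm_monoid)
  assume "p \<in> var_ideal_power n d" "q \<in> var_ideal n"
  then show ?thesis
    using ideal_prod.prod[of p "var_ideal_power n d" q "var_ideal n" "poly_ring n"]
    by (simp add: var_ideal_power_def ideals_set_def)
qed

lemma cring_trunc_ring: "cring (trunc_ring n d)"
  unfolding trunc_ring_def by (rule ideal.quotient_is_cring[OF ideal_var_ideal_power cring_poly_ring])

lemma mconst_hom: "mconst \<in> Ring.ring_hom class_ring (poly_ring n)"
  by (rule ring_hom_memI)
     (auto simp: mconst_def carrier_poly_ring zero_in_monomials single_add mult_single)

lemma trunc_const_hom: "trunc_const n d \<in> Ring.ring_hom class_ring (trunc_ring n d)"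
  using ring_hom_trans[OF mconst_hom ideal.rcos_ring_hom[OF ideal_var_ideal_power, of n d]]
  by (simp add: trunc_const_def[abs_def] trunc_ring_def comp_def)

text \<open>Each of the \<open>d\<close> steps of the induction splits one variable off the
  monomial, lowering its degree by one.\<close>

lemma single_in_var_ideal_power:
  assumes "m \<in> monomials n" "d \<le> mdegree m"
  shows "Poly_Mapping.single m c \<in> var_ideal_power n d"
  using assms
proof (induction d arbitrary: m)
  \<comment> \<open>The zeroth power is the unit of the monoid of ideals, namely the whole
    ring.\<close>
  case 0
  then show ?case
    by (simp add: var_ideal_power_def ideals_set_def carrier_poly_ring)
next
  case (Suc d)
  then obtain i where i: "i \<in> Poly_Mapping.keys m" by (force simp: mdegree_def)
  define m' where "m' = m - Poly_Mapping.single i 1"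
  have m: "m = m' + Poly_Mapping.single i 1"
    using i by (auto simp: m'_def poly_mapping_eq_iff fun_eq_iff lookup_add lookup_minus lookup_single when_def in_keys_iff)
  have keys: "Poly_Mapping.keys m = insert i (Poly_Mapping.keys m')"
    by (auto simp: m in_keys_iff lookup_add lookup_single when_def split: if_splits)
  have "mdegree m = (\<Sum>j\<in>Poly_Mapping.keys m. Poly_Mapping.lookup m' j + (if j = i then 1 else 0))"
    unfolding mdegree_def by (rule sum.cong) (auto simp: m lookup_add lookup_single when_def)
  also have "\<dots> = (\<Sum>j\<in>Poly_Mapping.keys m. Poly_Mapping.lookup m' j) + 1"
    using i by (simp add: sum.distrib)
  also have "(\<Sum>j\<in>Poly_Mapping.keys m. Poly_Mapping.lookup m' j) = mdegree m'"
    unfolding mdegree_def keys by (rule sum.mono_neutral_right) (auto simp: in_keys_iff)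
  finally have deg: "mdegree m = mdegree m' + 1" .
  interpret cring "poly_ring n :: 'a mpoly ring" by (rule cring_poly_ring)
  have "mvar i \<in> (var_ideal n :: 'a mpoly set)"
    unfolding var_ideal_def using i Suc.prems
    by (intro subsetD[OF genideal_self] imageI) (auto simp: mvar_def carrier_poly_ring monomials_def)
  moreover have "Poly_Mapping.single m' c \<in> var_ideal_power n d"
    using Suc.prems keys deg by (intro Suc.IH) (auto simp: monomials_def)
  ultimately have "Poly_Mapping.single m' c * mvar i \<in> var_ideal_power n (Suc d)"
    by (intro var_ideal_power_Suc)
  then show ?case by (simp add: mvar_def mult_single m)
qed

text \<open>Every exponent is bounded by the total degree, and only the first \<open>n\<close>
  exponents can be nonzero.\<close>

lemma finite_monomials_less: "finite {m \<in> monomials n. mdegree m < d}"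
proof -
  have "Poly_Mapping.lookup m i \<le> mdegree m" for m i
    by (cases "i \<in> Poly_Mapping.keys m") (auto simp: mdegree_def in_keys_iff intro: member_le_sum)
  then have "Poly_Mapping.lookup ` {m \<in> monomials n. mdegree m < d}
      \<subseteq> {f. \<forall>i. (i \<in> {..<n} \<longrightarrow> f i \<in> {..<d}) \<and> (i \<notin> {..<n} \<longrightarrow> f i = 0)}"
    by (auto simp: monomials_def in_keys_iff subset_iff intro: le_less_trans)
  then have "finite (Poly_Mapping.lookup ` {m \<in> monomials n. mdegree m < d})"
    by (rule finite_subset) (intro finite_set_of_finite_funs; simp)
  then show ?thesis
    by (rule finite_imageD) (auto intro: inj_onI poly_mapping_eqI)
qed

lemma field_algebra_trunc_ring:
  "field_algebra (trunc_ring n d) (class_ring :: 'k::field ring) (trunc_const n d)"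
  unfolding field_algebra_def field_algebra_axioms_def
  by (intro conjI cring_trunc_ring class_field.field_axioms trunc_const_hom)

text \<open>The classes of the monomials of degree below \<open>d\<close> generate the quotient,
  since all monomials of higher degree lie in \<open>var_ideal_power n d\<close>.\<close>

lemma fin_dim_trunc_ring:
  "vectorspace.fin_dim (class_ring :: 'k::field ring)
    (restrict_scalars (trunc_const n d) (ideal_module (trunc_ring n d) (carrier (trunc_ring n d))))"
proof -
  let ?P = "poly_ring n :: 'k mpoly ring"
  let ?R = "trunc_ring n d :: 'k mpoly set ring"
  let ?V = "restrict_scalars (trunc_const n d) (ideal_module ?R (carrier ?R))"
  define \<pi> :: "'k mpoly \<Rightarrow> 'k mpoly set" where "\<pi> p = var_ideal_power n d +>\<^bsub>?P\<^esub> p" for p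
  define B where "B = (\<lambda>m. \<pi> (Poly_Mapping.single m 1)) ` {m \<in> monomials n. mdegree m < d}"
  interpret field_algebra ?R class_ring "trunc_const n d" by (rule field_algebra_trunc_ring)
  interpret V: vectorspace class_ring ?V
    by (intro vectorspace_restrict_scalars module_ideal_module R.is_cring R.oneideal)
  interpret J: ideal "var_ideal_power n d" ?P by (rule ideal_var_ideal_power)
  have \<pi>: "\<pi> \<in> Ring.ring_hom ?P ?R"
    unfolding \<pi>_def[abs_def] trunc_ring_def by (rule J.rcos_ring_hom)
  have carrier: "carrier ?V = \<pi> ` carrier ?P"
    by (auto simp: restrict_scalars_def trunc_ring_def \<pi>_def FactRing_def A_RCOSETS_def')
  have zero: "\<pi> p = \<zero>\<^bsub>?V\<^esub>" if "p \<in> var_ideal_power n d" for p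
    using J.a_rcos_const[OF that] by (simp add: restrict_scalars_def trunc_ring_def \<pi>_def FactRing_def)
  have add: "\<pi> (p + q) = \<pi> p \<oplus>\<^bsub>?V\<^esub> \<pi> q" if "p \<in> carrier ?P" "q \<in> carrier ?P" for p q
    using ring_hom_add[OF \<pi> that] by (simp add: restrict_scalars_def)
  \<comment> \<open>Scalars act through \<open>trunc_const\<close>, hence as multiplication by a
    constant polynomial.\<close>
  have single: "\<pi> (Poly_Mapping.single m c) = c \<odot>\<^bsub>?V\<^esub> \<pi> (Poly_Mapping.single m 1)"
    if "m \<in> monomials n" for m c
  proof -
    have "mconst c \<in> carrier ?P" "Poly_Mapping.single m 1 \<in> carrier ?P"
      using that by (auto simp: mconst_def carrier_poly_ring zero_in_monomials)
    from ring_hom_mult[OF \<pi> this] show ?thesis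
      by (simp add: restrict_scalars_def mconst_def mult_single trunc_const_def \<pi>_def)
  qed
  have B: "B \<subseteq> carrier ?V" "finite B"
    using finite_monomials_less by (auto simp: B_def carrier carrier_poly_ring)
  interpret span: LinearCombinations.submodule class_ring "V.span B" ?V
    by (rule V.span_is_submodule[OF B(1)])
  have "\<pi> (Poly_Mapping.single m c) \<in> V.span B" if m: "m \<in> monomials n" for m c
  proof (cases "mdegree m < d")
    case True
    then have "\<pi> (Poly_Mapping.single m 1) \<in> V.span B"
      using m V.in_own_span[OF B(1)] by (auto simp: B_def)
    then show ?thesis by (subst single[OF m]) (simp add: span.smult_closed)
  next
    case False
    then show ?thesis using m by (simp add: zero single_in_var_ideal_power)
  qed note single_in_span = this
  have "\<pi> p \<in> V.span B" if "p \<in> carrier ?P" for p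
    using that
  proof (induction p rule: update_induct)
    case const
    have "0 \<in> (var_ideal_power n d :: 'k mpoly set)"
      using additive_subgroup.zero_closed[OF J.additive_subgroup_axioms] by simp
    then show ?case by (simp add: zero)
  next
    case (update f a b)
    \<comment> \<open>The coefficient of \<open>f\<close> at \<open>a\<close> is zero before the
      update, so updating amounts to adding a single term.\<close>
    have eq: "Poly_Mapping.update a b f = f + Poly_Mapping.single a b"
      using update(1)
      by (intro poly_mapping_eqI) (auto simp: lookup_update lookup_add lookup_single in_keys_iff)
    have "Poly_Mapping.keys (Poly_Mapping.update a b f) = insert a (Poly_Mapping.keys f)"
      using update(2) by (auto simp: in_keys_iff lookup_update split: if_splits)
    then have "f \<in> carrier ?P" "a \<in> monomials n" using update.prems by (auto simp: carrier_poly_ring)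
    then show ?case
      unfolding eq using update.IH single_in_span by (subst add) (auto simp: carrier_poly_ring)
  qed
  then have "carrier ?V \<subseteq> V.span B" by (auto simp: carrier)
  then show ?thesis unfolding V.fin_dim_def
    using B V.span_is_subset2[OF B(1)] by blast
qed

section \<open>The Hilbert--Dyck series\<close>

text \<open>Weight each edge by 1 if its label is outside \<open>S\<close> and by 0 otherwise.
  Recursion over the forest shows that the total is 0, so no such edge exists.\<close>

lemma edge_labels_in_forest:
  assumes "ts \<in> forests S" "(u, v, I) \<in> tree_edges (Node ts)"
  shows "I \<in> S"
proof -
  have "(\<Sum>(u, v, J)\<in>tree_edges (Node ts). if J \<in> S then 0 else 1 :: nat) = 0"
    using assms(1) by induction (simp_all add: sum_tree_edges_Cons)
  with assms(2) show ?thesis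
    by (auto simp: sum_eq_0_iff finite_tree_edges split: if_splits)
qed

theorem theorem4p5:
  fixes n d :: nat
    and S :: "((nat \<Rightarrow>\<^sub>0 nat) \<Rightarrow>\<^sub>0 'k::field) set set set"
  assumes "n > 0" and "d > 0"
    and "finite S" and "\<And>I. I \<in> S \<Longrightarrow> ideal I (trunc_ring n d)"
  shows "algebraic_fps (HD n d S)"
proof -
  interpret field_algebra "trunc_ring n d :: 'k mpoly set ring" "class_ring :: 'k ring" "trunc_const n d"
    by (rule field_algebra_trunc_ring)
  define D where "D = dim_over (ideal_module (trunc_ring n d) (carrier (trunc_ring n d)))"
  define f where "f I = dim_over (ideal_module (trunc_ring n d) I)" for I
  have dim: "dim_Spl n d (Node ts) = D + (\<Sum>(u, v, I)\<in>tree_edges (Node ts). f I)"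
    if "ts \<in> forests S" for ts
  proof -
    have "ideal I (trunc_ring n d)" if "(u, v, I) \<in> tree_edges (Node ts)" for u v I
      using edge_labels_in_forest[OF \<open>ts \<in> forests S\<close> that] assms(4) by blast
    from dim_Spl_rooted_tree[OF rooted_tree_ptree fin_dim_trunc_ring this]
    show ?thesis by (simp add: dim_Spl_def D_def f_def)
  qed
  have "HD n d S = forest_series S
      (\<lambda>ts. of_nat D + (\<Sum>(u, v, I)\<in>tree_edges (Node ts). of_nat (f I)))"
  proof (rule fps_ext)
    fix m
    \<comment> \<open>Injectivity of \<open>forest_word\<close> makes this a bijection, so each
      coefficient becomes a sum over forests with \<open>m\<close> edges.\<close>
    have words: "{w \<in> dyck S. card (tree_edges (tree_of_word w)) = m} = forest_word ` forest_level S m"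
      by (auto simp: dyck_eq_forest_words tree_of_forest_word forest_level_def)
    have "HD n d S $ m = (\<Sum>ts\<in>forest_level S m. of_nat (dim_Spl n d (Node ts)))"
      unfolding HD_def fps_nth_Abs_fps words
      by (subst sum.reindex) (auto simp: inj_on_subset[OF inj_forest_word] tree_of_forest_word)
    also have "\<dots> = forest_series S
        (\<lambda>ts. of_nat D + (\<Sum>(u, v, I)\<in>tree_edges (Node ts). of_nat (f I))) $ m"
      unfolding forest_series_def fps_nth_Abs_fps
      by (intro sum.cong refl) (simp add: forest_level_def dim case_prod_beta)
    finally show "HD n d S $ m = forest_series S
        (\<lambda>ts. of_nat D + (\<Sum>(u, v, I)\<in>tree_edges (Node ts). of_nat (f I))) $ m" .
  qed
  then show ?thesis using algebraic_fps_weighted_forests[OF \<open>finite S\<close>] by simp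
qed

end
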